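(* There exists a $\gamma$-OCS with $\gamma = \frac{13\sqrt{13}-35}{108} > 0.1099$.
   Context: Consider a set of ground elements. The input is a sequence of pairs, each consisting of two distinct elements; the sequence is fixed in advance (obliviously) and revealed one pair at a time. A (randomized) online selection algorithm must, upon seeing each pair and before seeing later pairs, irrevocably select one of the two elements of that pair. A subsequence (not necessarily contiguous in the whole sequence) of pairs all containing an element $i$ is called consecutive (with respect to $i$) if it includes all the pairs of the sequence that contain $i$ between its first and its last pair. Two subsequences are disjoint if no pair (i.e. no position in the sequence) belongs to both. For $\gamma\in[0,1]$, a $\gamma$-OCS (online correlated selection) is a randomized online selection algorithm such that, for every input sequence, every element $i$, and any pairwise disjoint subsequences of $k_1,k_2,\dots,k_m\geq 1$ consecutive pairs containing $i$, the element $i$ is selected in at least one of these pairs with probability at least $$1-\prod_{\ell=1}^m 2^{-k_\ell}(1-\gamma)^{k_\ell-1}.$$ *)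

theory Defs
  imports "HOL-Probability.Probability"
begin

text \<open>
  The ground elements are the elements of the type \<open>'a\<close>. An unordered pair of distinct elements is
  a two-element set, and an input is a finite list of such pairs.
\<close>

definition pair_sequence :: "'a set list \<Rightarrow> bool" where
  "pair_sequence es \<longleftrightarrow> (\<forall>e\<in>set es. card e = 2)"

text \<open>
  A deterministic online algorithm maps each nonempty prefix of the input, i.e. everything revealed
  up to and including the current pair, to the element it selects from that current pair. It is not
  told the length of the input. Its own earlier selections are determined by the prefix, so they
  need not be passed as arguments.
\<close>

type_synonym 'a selector = "'a set list \<Rightarrow> 'a"

definition online_selector :: "'a selector \<Rightarrow> bool" where
  "online_selector A \<longleftrightarrow> (\<forall>es. es \<noteq> [] \<longrightarrow> pair_sequence es \<longrightarrow> A es \<in> last es)"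

text \<open>
  A randomized online algorithm is a probability distribution on deterministic ones. One and the
  same distribution serves all inputs, and inputs do not depend on the outcome drawn from it
  (oblivious adversary). The measurability condition makes every event about the selections on a
  finite input an event of the probability space.
\<close>

definition randomized_online_selector :: "'a selector measure \<Rightarrow> bool" where
  "randomized_online_selector M \<longleftrightarrow>
     prob_space M \<and>
     (\<forall>A\<in>space M. online_selector A) \<and>
     (\<forall>es. es \<noteq> [] \<longrightarrow> pair_sequence es \<longrightarrow> (\<lambda>A. A es) \<in> measurable M (count_space UNIV))"

text \<open>
  Subsequences are represented by their sets of positions, so that equal pairs occurring at
  different positions are kept apart. The element selected at position \<open>t\<close> of the input \<open>es\<close> is
  \<open>A (take (Suc t) es)\<close>.
\<close>

definition positions_containing :: "'a set list \<Rightarrow> 'a \<Rightarrow> nat set" where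
  "positions_containing es i = {t. t < length es \<and> i \<in> es ! t}"

definition consecutive_wrt :: "'a set list \<Rightarrow> 'a \<Rightarrow> nat set \<Rightarrow> bool" where
  "consecutive_wrt es i S \<longleftrightarrow>
     S \<noteq> {} \<and> S \<subseteq> positions_containing es i \<and>
     (\<forall>t\<in>positions_containing es i. Min S \<le> t \<and> t \<le> Max S \<longrightarrow> t \<in> S)"

definition OCS :: "real \<Rightarrow> 'a selector measure \<Rightarrow> bool" where
  "OCS \<gamma> M \<longleftrightarrow>
     0 \<le> \<gamma> \<and> \<gamma> \<le> 1 \<and> randomized_online_selector M \<and>
     (\<forall>es i (m::nat) S. pair_sequence es \<longrightarrow>
        (\<forall>l<m. consecutive_wrt es i (S l)) \<longrightarrow> disjoint_family_on S {..<m} \<longrightarrow>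
        measure M {A \<in> space M. \<exists>l<m. \<exists>t\<in>S l. A (take (Suc t) es) = i}
          \<ge> 1 - (\<Prod>l<m. (1 / 2) ^ card (S l) * (1 - \<gamma>) ^ (card (S l) - 1)))"

end

theory Submission
  imports Defs
begin

text \<open>
  Every pair is independently a sender with probability \<open>p\<close> and a receiver otherwise. A sender
  announces its (fair) selection along one of its two elements, chosen uniformly, to the next pair
  containing that element. A receiver with an announcement along \<open>u\<close> selects \<open>u\<close> iff the sender
  did not, breaking ties between two announcements uniformly; all other pairs select by a fresh fair
  coin.

  Let \<open>U\<close> be the union of the given subsequences. If some receiver in \<open>U\<close> is matched with a sender in
  \<open>U\<close>, along whichever element, then \<open>i\<close> is selected by one of the two. Otherwise the selections in
  \<open>U\<close> depend on distinct coins and \<open>i\<close> is missed with probability \<open>2^-|U|\<close>. So it suffices that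
  each pair of \<open>U\<close> whose predecessor with respect to \<open>i\<close> is in \<open>U\<close> is matched within \<open>U\<close> with
  conditional probability at least \<open>\<gamma> = p/2 * (1 - p) * (1 - p/4)\<close>, given that no earlier pair is:
  the predecessor sends along \<open>i\<close>, the pair receives, and it is not diverted by a competing
  announcement from outside \<open>U\<close>, which happens with probability at most \<open>p/2 * 1/2\<close>. A competitor
  inside \<open>U\<close> does no harm. The constant arises from the maximiser \<open>p = (5 - sqrt 13) / 3\<close>.
\<close>

subsection \<open>Finite and infinite products of probability mass functions\<close>

lemma prob_pair_pmf_Times:
  "measure_pmf.prob (pair_pmf p q) (S \<times> T) = measure_pmf.prob p S * measure_pmf.prob q T"
proof -
  have "measure_pmf.prob (pair_pmf p q) (S \<times> T) =
        measure_pmf.prob (pair_pmf p q) ((S \<inter> set_pmf p) \<times> (T \<inter> set_pmf q))"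
    by (rule measure_prob_cong_0) (auto simp: set_pmf_eq pmf_pair)
  also have "\<dots> = measure_pmf.prob p (S \<inter> set_pmf p) * measure_pmf.prob q (T \<inter> set_pmf q)"
    by (intro measure_pmf_prob_product) auto
  finally show ?thesis
    by (simp add: measure_Int_set_pmf)
qed

text \<open>Independence: \<open>Q\<close> ignores coordinate \<open>j\<close>, so splitting this
  coordinate off turns the joint event into a rectangle.\<close>

lemma prob_Pi_pmf_coord:
  assumes "finite I" "j \<in> I" and Q: "\<And>x v. Q (x(j := v)) = Q x"
  shows "measure_pmf.prob (Pi_pmf I d p) {x. Q x \<and> R (x j)} =
         measure_pmf.prob (Pi_pmf I d p) {x. Q x} * measure_pmf.prob (p j) {v. R v}"
proof -
  let ?P = "Pi_pmf (I - {j}) d p"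
  have eq: "Pi_pmf I d p = map_pmf (\<lambda>(v, x). x(j := v)) (pair_pmf (p j) ?P)"
    using Pi_pmf_insert[of "I - {j}" j d p] assms by (simp add: insert_absorb)
  have *: "measure_pmf.prob (Pi_pmf I d p) {x. Q x \<and> R' (x j)} =
           measure_pmf.prob (p j) {v. R' v} * measure_pmf.prob ?P {x. Q x}" for R'
  proof -
    have "(\<lambda>(v, x). x(j := v)) -` {x. Q x \<and> R' (x j)} = {v. R' v} \<times> {x. Q x}"
      using Q by auto
    then show ?thesis
      by (simp add: eq prob_pair_pmf_Times)
  qed
  from *[of R] *[of "\<lambda>_. True"] show ?thesis
    by simp
qed

text \<open>Negative correlation: where \<open>x o' = v\<close>, the event \<open>Q x\<close> may be
  replaced by \<open>Q (x(o' := v))\<close>, which ignores \<open>o'\<close> and implies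
  \<open>Q x\<close>.\<close>

lemma prob_Pi_pmf_value_le:
  assumes "finite I" "o' \<in> I" and min: "\<And>x. Q (x(o' := v)) \<Longrightarrow> Q x"
  shows "measure_pmf.prob (Pi_pmf I d p) {x. Q x \<and> x o' = v} \<le>
         measure_pmf.prob (Pi_pmf I d p) {x. Q x} * pmf (p o') v"
proof -
  have "{x. Q x \<and> x o' = v} = {x. Q (x(o' := v)) \<and> x o' = v}"
    by (auto simp: fun_upd_idem)
  then have "measure_pmf.prob (Pi_pmf I d p) {x. Q x \<and> x o' = v} =
        measure_pmf.prob (Pi_pmf I d p) {x. Q (x(o' := v))} * measure_pmf.prob (p o') {w. w = v}"
    using prob_Pi_pmf_coord[of I o' "\<lambda>x. Q (x(o' := v))" d p "\<lambda>w. w = v"] assms by simp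
  also have "measure_pmf.prob (p o') {w. w = v} = pmf (p o') v"
    by (simp add: measure_pmf_single)
  also have "measure_pmf.prob (Pi_pmf I d p) {x. Q (x(o' := v))} \<le>
             measure_pmf.prob (Pi_pmf I d p) {x. Q x}"
    using min by (intro measure_pmf.finite_measure_mono) auto
  finally show ?thesis
    by (simp add: mult_right_mono)
qed

lemma Pi_pmf_pair:
  assumes "finite I"
  shows "Pi_pmf I (d, d') (\<lambda>_. pair_pmf p q) =
         map_pmf (\<lambda>(x, c) t. (x t, c t)) (pair_pmf (Pi_pmf I d (\<lambda>_. p)) (Pi_pmf I d' (\<lambda>_. q)))"
    (is "?l = map_pmf ?f ?r")
proof (rule pmf_eqI)
  fix h :: "'a \<Rightarrow> 'b \<times> 'c"
  have "inj ?f"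
    by (rule injI) (auto simp: fun_eq_iff)
  then have "pmf (map_pmf ?f ?r) (?f (fst \<circ> h, snd \<circ> h)) = pmf ?r (fst \<circ> h, snd \<circ> h)"
    by (rule pmf_map_inj')
  also have "?f (fst \<circ> h, snd \<circ> h) = h"
    by auto
  also have "pmf ?r (fst \<circ> h, snd \<circ> h) = pmf ?l h"
    using assms by (auto simp: pmf_pair pmf_Pi prod.distrib[symmetric] prod_eq_iff
        intro!: prod.cong) (metis pmf_pair prod.collapse)+
  finally show "pmf ?l h = pmf (map_pmf ?f ?r) h"
    by simp
qed

text \<open>The length of the input is not known in advance, so the seeds form an infinite product.
  An event about the first \<open>n\<close> seeds is a finite disjoint union of cylinders, because a
  seed takes finitely many values; computations can thus move to the finite
  \<open>Pi_pmf\<close>.\<close>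

lemma measure_PiM_finite_prefix:
  fixes D :: "'b :: finite pmf"
  defines "M \<equiv> PiM UNIV (\<lambda>_::nat. measure_pmf D)"
  shows "{w \<in> space M. Q (\<lambda>t. if t < n then w t else d)} \<in> sets M" (is "?E \<in> _")
    and "measure M {w \<in> space M. Q (\<lambda>t. if t < n then w t else d)} =
         measure_pmf.prob (Pi_pmf {..<n} d (\<lambda>_. D)) {x. Q x}" (is "?l = ?r")
proof -
  interpret product_prob_space "\<lambda>_::nat. measure_pmf D" UNIV
    by unfold_locales
  define F where "F = {f \<in> PiE_dflt {..<n} d (\<lambda>_. UNIV). Q f}"
  define cyl where "cyl f = {w \<in> space M. \<forall>t\<in>{..<n}. w t \<in> {f t}}" for f
  have fin: "finite F"
    unfolding F_def by (rule finite_subset[OF _ finite_PiE_dflt[of "{..<n}" "\<lambda>_. UNIV"]]) auto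
  have cyl: "emeasure M (cyl f) = (\<Prod>t<n. emeasure (measure_pmf D) {f t})" for f
    unfolding cyl_def M_def using emeasure_PiM_Collect[of "{..<n}" "\<lambda>t. {f t}"] by simp
  have sets: "cyl f \<in> sets M" for f
    unfolding cyl_def M_def by measurable
  have cyl': "measure M (cyl f) = (\<Prod>t<n. pmf D (f t))" for f
    using cyl[of f] by (simp add: measure_def emeasure_pmf_single prod_ennreal prod_nonneg)
  have E: "?E = (\<Union>f\<in>F. cyl f)"
  proof (intro equalityI subsetI)
    fix w assume "w \<in> {w \<in> space M. Q (\<lambda>t. if t < n then w t else d)}"
    then show "w \<in> (\<Union>f\<in>F. cyl f)"
      by (intro UN_I[of "\<lambda>t. if t < n then w t else d"]) (auto simp: F_def PiE_dflt_def cyl_def)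
  next
    fix w assume "w \<in> (\<Union>f\<in>F. cyl f)"
    then obtain f where f: "f \<in> F" "w \<in> cyl f" by blast
    then have "(\<lambda>t. if t < n then w t else d) = f"
      by (auto simp: F_def PiE_dflt_def cyl_def)
    with f show "w \<in> {w \<in> space M. Q (\<lambda>t. if t < n then w t else d)}"
      by (auto simp: F_def cyl_def)
  qed
  from E fin sets show "?E \<in> sets M"
    by auto
  have "?l = measure M (\<Union>f\<in>F. cyl f)"
    by (simp add: E)
  also have "\<dots> = (\<Sum>f\<in>F. measure M (cyl f))"
  proof (unfold M_def, rule finite_measure_finite_Union[OF fin])
    show "cyl ` F \<subseteq> sets (PiM UNIV (\<lambda>_. measure_pmf D))"
      using sets by (auto simp: M_def)
    show "disjoint_family_on cyl F"
      unfolding disjoint_family_on_def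
    proof (intro ballI impI)
      fix f g assume fg: "f \<in> F" "g \<in> F" "f \<noteq> g"
      then obtain t where t: "f t \<noteq> g t" by blast
      have "t < n"
      proof (rule ccontr)
        assume "\<not> t < n"
        with fg(1,2) have "f t = d" "g t = d"
          by (auto simp: F_def PiE_dflt_def)
        with t show False by simp
      qed
      with t show "cyl f \<inter> cyl g = {}"
        by (auto simp: cyl_def)
    qed
  qed
  also have "\<dots> = (\<Sum>f\<in>F. pmf (Pi_pmf {..<n} d (\<lambda>_. D)) f)"
    by (intro sum.cong refl, subst pmf_Pi') (auto simp: cyl' F_def PiE_dflt_def)
  also have "\<dots> = measure_pmf.prob (Pi_pmf {..<n} d (\<lambda>_. D)) F"
    by (simp add: measure_measure_pmf_finite fin)
  also have "\<dots> = ?r"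
    by (rule measure_prob_cong_0) (auto simp: F_def PiE_dflt_def pmf_Pi)
  finally show "?l = ?r" .
qed

subsection \<open>Matching and selection\<close>

definition other :: "'a set \<Rightarrow> 'a \<Rightarrow> 'a" where
  "other e u = (THE v. v \<in> e \<and> v \<noteq> u)"

lemma other_eq: "card e = 2 \<Longrightarrow> u \<in> e \<Longrightarrow> v \<in> e \<Longrightarrow> v \<noteq> u \<Longrightarrow> other e u = v"
  unfolding other_def by (rule the_equality) (auto simp: card_2_iff)

lemma other_in:
  assumes "card e = 2" "u \<in> e"
  shows "other e u \<in> e" "other e u \<noteq> u"
proof -
  obtain v where "v \<in> e" "v \<noteq> u"
    using assms by (auto simp: card_2_iff)
  with other_eq[OF assms this] show "other e u \<in> e" "other e u \<noteq> u"
    by auto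
qed

text \<open>Elements are encoded by bits so that the distribution of the seeds does not depend on
  the input.\<close>

definition pick :: "'a set \<Rightarrow> bool \<Rightarrow> 'a" where
  "pick e b = (if b then SOME v. v \<in> e else other e (SOME v. v \<in> e))"

lemma pick_in:
  assumes "card e = 2"
  shows "pick e b \<in> e"
proof -
  have "(SOME v. v \<in> e) \<in> e"
    using assms by (intro some_in_eq[THEN iffD2]) auto
  with assms show ?thesis
    by (simp add: pick_def other_in)
qed

lemma pick_inj:
  assumes "card e = 2"
  shows "pick e b = pick e b' \<longleftrightarrow> b = b'"
proof -
  have "pick e True \<in> e" "pick e False = other e (pick e True)"
    using assms by (auto simp: pick_in) (simp add: pick_def)
  then have "pick e False \<noteq> pick e True"
    using other_in(2)[OF assms] by metis
  then show ?thesis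
    by (cases b; cases b') auto
qed

lemma pick_surj:
  assumes "card e = 2" "u \<in> e"
  shows "\<exists>b. pick e b = u"
proof -
  have "pick e True \<in> e" "pick e False \<in> e" "pick e True \<noteq> pick e False"
    using assms by (simp_all add: pick_in pick_inj)
  then show ?thesis
    using assms by (auto simp: card_2_iff)
qed

definition is_prev :: "(nat \<Rightarrow> 'a set) \<Rightarrow> 'a \<Rightarrow> nat \<Rightarrow> nat \<Rightarrow> bool" where
  "is_prev e u s t \<longleftrightarrow> s < t \<and> u \<in> e s \<and> u \<in> e t \<and> (\<forall>r. s < r \<and> r < t \<longrightarrow> u \<notin> e r)"

lemma is_prev_unique_left: "is_prev e u s t \<Longrightarrow> is_prev e u s' t \<Longrightarrow> s = s'"
  unfolding is_prev_def by (metis linorder_neqE_nat)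

lemma is_prev_unique_right: "is_prev e u s t \<Longrightarrow> is_prev e u s t' \<Longrightarrow> t = t'"
  unfolding is_prev_def by (metis linorder_neqE_nat)

text \<open>
  In the role \<open>x t\<close> of position \<open>t\<close>, the first bit says whether \<open>t\<close> is a sender. The second bit picks
  the element along which a sender announces, and the preferred element of a receiver.
\<close>

definition offer :: "(nat \<Rightarrow> 'a set) \<Rightarrow> (nat \<Rightarrow> bool \<times> bool) \<Rightarrow> 'a \<Rightarrow> nat \<Rightarrow> nat \<Rightarrow> bool" where
  "offer e x u s t \<longleftrightarrow> is_prev e u s t \<and> fst (x s) \<and> pick (e s) (snd (x s)) = u \<and> \<not> fst (x t)"

definition matched :: "(nat \<Rightarrow> 'a set) \<Rightarrow> (nat \<Rightarrow> bool \<times> bool) \<Rightarrow> 'a \<Rightarrow> nat \<Rightarrow> nat \<Rightarrow> bool" where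
  "matched e x u s t \<longleftrightarrow> offer e x u s t \<and>
     (pick (e t) (snd (x t)) = u \<or> \<not> (\<exists>u' s'. u' \<noteq> u \<and> offer e x u' s' t))"

text \<open>A matched \<open>s\<close> is a sender, hence never matched as a receiver, so
  \<open>pick (e s) (c s)\<close> is its actual selection. This avoids recursion.\<close>

definition selection ::
    "(nat \<Rightarrow> 'a set) \<Rightarrow> (nat \<Rightarrow> bool \<times> bool) \<Rightarrow> (nat \<Rightarrow> bool) \<Rightarrow> nat \<Rightarrow> 'a" where
  "selection e x c t =
     (if \<exists>u s. matched e x u s t
      then let (u, s) = (THE (u, s). matched e x u s t)
           in if pick (e s) (c s) = u then other (e t) u else u
      else pick (e t) (c t))"

lemma matched_unique: "matched e x u s t \<Longrightarrow> matched e x u' s' t \<Longrightarrow> u = u' \<and> s = s'"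
  unfolding matched_def offer_def by (metis is_prev_unique_left)

text \<open>A sender announces along one element only, to the next pair containing it. Hence no two
  receivers depend on the same sender's coin.\<close>

lemma matched_unique_right: "matched e x u s t \<Longrightarrow> matched e x u' s t' \<Longrightarrow> t = t'"
  unfolding matched_def offer_def by (metis is_prev_unique_right)

lemma selection_matched:
  "matched e x u s t \<Longrightarrow>
     selection e x c t = (if pick (e s) (c s) = u then other (e t) u else u)"
proof -
  assume m: "matched e x u s t"
  then have "(THE (u, s). matched e x u s t) = (u, s)"
    by (intro the_equality) (auto dest: matched_unique)
  with m show ?thesis
    unfolding selection_def by (auto simp: Let_def)
qed

lemma selection_unmatched:
  "\<nexists>u s. matched e x u s t \<Longrightarrow> selection e x c t = pick (e t) (c t)"
  by (simp add: selection_def)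

lemma selection_in:
  assumes "card (e t) = 2"
  shows "selection e x c t \<in> e t"
proof (cases "\<exists>u s. matched e x u s t")
  case True
  then obtain u s where m: "matched e x u s t" by blast
  then have "u \<in> e t" by (auto simp: matched_def offer_def is_prev_def)
  with assms show ?thesis by (simp add: selection_matched[OF m] other_in)
qed (simp add: selection_unmatched pick_in assms)

lemma offer_cong:
  assumes "\<And>s. s \<le> t \<Longrightarrow> e s = e' s" "\<And>s. s \<le> t \<Longrightarrow> x s = x' s"
  shows "offer e x u s t = offer e' x' u s t"
  using assms unfolding offer_def is_prev_def by (metis less_imp_le order_refl)

lemma matched_cong:
  assumes "\<And>s. s \<le> t \<Longrightarrow> e s = e' s" "\<And>s. s \<le> t \<Longrightarrow> x s = x' s"
  shows "matched e x u s t = matched e' x' u s t"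
proof -
  have "offer e x u s t = offer e' x' u s t" for u s
    by (rule offer_cong) (use assms in auto)
  then show ?thesis
    using assms unfolding matched_def by simp
qed

text \<open>This is the online property. It allows passing from an input to its prefixes and
  truncating the seeds.\<close>

lemma selection_cong:
  assumes "\<And>s. s \<le> t \<Longrightarrow> e s = e' s" "\<And>s. s \<le> t \<Longrightarrow> x s = x' s" "\<And>s. s \<le> t \<Longrightarrow> c s = c' s"
  shows "selection e x c t = selection e' x' c' t"
proof (cases "\<exists>u s. matched e x u s t")
  case True
  then obtain u s where m: "matched e x u s t" by blast
  then have m': "matched e' x' u s t"
    using matched_cong[of t e e' x x'] assms by blast
  have "s \<le> t"
    using m by (auto simp: matched_def offer_def is_prev_def)
  then show ?thesis
    using assms by (simp add: selection_matched[OF m] selection_matched[OF m'])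
next
  case False
  then have "\<nexists>u s. matched e' x' u s t"
    using matched_cong[of t e e' x x'] assms by blast
  with False show ?thesis
    using assms by (simp add: selection_unmatched)
qed

definition matched_within ::
    "(nat \<Rightarrow> 'a set) \<Rightarrow> (nat \<Rightarrow> bool \<times> bool) \<Rightarrow> nat set \<Rightarrow> nat \<Rightarrow> bool" where
  "matched_within e x U t \<longleftrightarrow> (\<exists>u s. s \<in> U \<and> matched e x u s t)"

text \<open>The sender \<open>s\<close> selects by its own coin. Suppose this does not give
  \<open>i\<close>. If \<open>u = i\<close>, the receiver takes \<open>i\<close>. Otherwise both
  pairs equal \<open>{i, u}\<close>, so the sender took \<open>u\<close> and the receiver takes the
  other element, which is \<open>i\<close>.\<close>

lemma selected_if_matched_within:
  assumes card: "\<And>t. t \<in> U \<Longrightarrow> card (e t) = 2" and i: "\<And>t. t \<in> U \<Longrightarrow> i \<in> e t"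
    and t: "t \<in> U" "matched_within e x U t"
  shows "\<exists>t\<in>U. selection e x c t = i"
proof -
  from t obtain u s where s: "s \<in> U" and m: "matched e x u s t"
    by (auto simp: matched_within_def)
  have sel_t: "selection e x c t = (if pick (e s) (c s) = u then other (e t) u else u)"
    by (rule selection_matched[OF m])
  have "\<nexists>u' s'. matched e x u' s' s"
    using m by (auto simp: matched_def offer_def)
  then have sel_s: "selection e x c s = pick (e s) (c s)"
    by (rule selection_unmatched)
  have u: "u \<in> e s" "u \<in> e t"
    using m by (auto simp: matched_def offer_def is_prev_def)
  show ?thesis
  proof (cases "pick (e s) (c s) = i")
    case True
    then show ?thesis using s sel_s by auto
  next
    case False
    note ni = False
    show ?thesis
    proof (cases "u = i")
      case True
      then show ?thesis using sel_t ni t by auto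
    next
      case False
      then have "pick (e s) (c s) = u"
        using ni card[OF s] i[OF s] u(1) pick_in[OF card[OF s], of "c s"]
        by (auto simp: card_2_iff)
      then have "selection e x c t = i"
        using sel_t other_eq[OF card[OF t(1)] u(2) i[OF t(1)]] False by auto
      then show ?thesis using t by auto
    qed
  qed
qed

text \<open>The roles \<open>x\<close> are fixed. Missing \<open>i\<close> at \<open>t\<close>
  determines one coin, either that of \<open>t\<close> or that of a sender outside \<open>U\<close>.
  These coins are distinct for distinct \<open>t\<close>, hence independent.\<close>

lemma prob_coins_unselected_le:
  assumes U: "U \<subseteq> {..<n}" and card: "\<And>t. t < n \<Longrightarrow> card (e t) = 2"
    and i: "\<And>t. t \<in> U \<Longrightarrow> i \<in> e t" and nm: "\<And>t. t \<in> U \<Longrightarrow> \<not> matched_within e x U t"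
  shows "measure_pmf.prob (Pi_pmf {..<n} d (\<lambda>_. bernoulli_pmf (1/2)))
           {c. \<forall>t\<in>U. selection e x c t \<noteq> i} \<le> (1/2) ^ card U"
proof -
  have finU: "finite U"
    using U finite_subset by blast
  have "\<exists>j b. j < n \<and> (\<forall>c. selection e x c t \<noteq> i \<longrightarrow> c j = b) \<and>
      (j = t \<or> (j \<notin> U \<and> (\<exists>u. matched e x u j t)))" if t: "t \<in> U" for t
  proof (cases "\<exists>u s. matched e x u s t")
    case True
    then obtain u s where m: "matched e x u s t" by blast
    then have st: "s < t" "u \<in> e s" "u \<in> e t"
      by (auto simp: matched_def offer_def is_prev_def)
    have tn: "t < n" using t U by auto
    then have sn: "s < n" using st by simp
    have sU: "s \<notin> U"
      using nm[OF t] m by (auto simp: matched_within_def)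
    obtain b where b: "pick (e s) b = u"
      using pick_surj[OF card[OF sn] st(2)] by blast
    have pc: "pick (e s) (c s) = u \<longleftrightarrow> c s = b" for c
      using b pick_inj[OF card[OF sn]] by auto
    \<comment> \<open>If \<open>u = i\<close>, then \<open>i\<close> is missed only when the sender
      took \<open>i\<close>; otherwise only when the sender did not take \<open>u\<close>.\<close>
    have "selection e x c t \<noteq> i \<longrightarrow> c s = (b = (u = i))" for c
      using other_eq[OF card[OF tn] st(3) i[OF t]]
      by (auto simp: selection_matched[OF m] pc)
    then show ?thesis
      using sn sU m by blast
  next
    case False
    have tn: "t < n" using t U by auto
    obtain b where "pick (e t) b = i"
      using pick_surj[OF card[OF tn] i[OF t]] by blast
    then have "selection e x c t \<noteq> i \<longrightarrow> c t = (\<not> b)" for c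
      using False by (cases "c t"; cases b) (auto simp: selection_unmatched)
    then show ?thesis
      using tn by blast
  qed
  then obtain src b where src: "\<And>t. t \<in> U \<Longrightarrow> src t < n"
      "\<And>t c. t \<in> U \<Longrightarrow> selection e x c t \<noteq> i \<Longrightarrow> c (src t) = b t"
      "\<And>t. t \<in> U \<Longrightarrow> src t = t \<or> (src t \<notin> U \<and> (\<exists>u. matched e x u (src t) t))"
    by metis
  \<comment> \<open>Own coins have positions in \<open>U\<close>, senders' coins have positions
    outside, and no sender serves two receivers.\<close>
  have inj: "inj_on src U"
    by (rule inj_onI) (metis src(3) matched_unique_right)
  define B where "B j = (if j \<in> src ` U then {b (the_inv_into U src j)} else UNIV)" for j
  have "measure_pmf.prob (Pi_pmf {..<n} d (\<lambda>_. bernoulli_pmf (1/2)))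
           {c. \<forall>t\<in>U. selection e x c t \<noteq> i} \<le>
        measure_pmf.prob (Pi_pmf {..<n} d (\<lambda>_. bernoulli_pmf (1/2))) (Pi {..<n} B)"
  proof (intro measure_pmf.finite_measure_mono subsetI)
    fix c assume "c \<in> {c. \<forall>t\<in>U. selection e x c t \<noteq> i}"
    then have "c (src t) = b t" if "t \<in> U" for t
      using src(2) that by blast
    then show "c \<in> Pi {..<n} B"
      by (auto simp: B_def the_inv_into_f_f[OF inj])
  qed simp
  also have "\<dots> = (\<Prod>j<n. measure_pmf.prob (bernoulli_pmf (1/2)) (B j))"
    by (rule measure_Pi_pmf_Pi) auto
  also have "\<dots> = (\<Prod>j<n. if j \<in> src ` U then 1/2 else 1)"
  proof (rule prod.cong)
    fix j
    show "measure_pmf.prob (bernoulli_pmf (1/2)) (B j) = (if j \<in> src ` U then 1/2 else 1)"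
      by (cases "b (the_inv_into U src j)") (auto simp: B_def measure_pmf_single)
  qed auto
  also have "\<dots> = (1/2) ^ card (src ` U)"
    using src(1) by (subst prod.If_cases) (auto simp: Int_absorb1 image_subset_iff)
  also have "card (src ` U) = card U"
    by (rule card_image[OF inj])
  finally show ?thesis .
qed

subsection \<open>The probability of having no match\<close>

definition role_pmf :: "real \<Rightarrow> (bool \<times> bool) pmf" where
  "role_pmf p = pair_pmf (bernoulli_pmf p) (bernoulli_pmf (1/2))"

lemma prob_role:
  assumes "0 \<le> p" "p \<le> 1"
  shows "measure_pmf.prob (role_pmf p) {(True, b)} = p / 2"
    and "measure_pmf.prob (role_pmf p) {(False, b)} = (1 - p) / 2"
    and "measure_pmf.prob (role_pmf p) {v. \<not> fst v} = 1 - p"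
proof -
  show *: "measure_pmf.prob (role_pmf p) {(True, b)} = p / 2"
    "measure_pmf.prob (role_pmf p) {(False, b)} = (1 - p) / 2" for b
    using assms by (cases b; simp add: measure_pmf_single role_pmf_def pmf_pair)+
  have "{v. \<not> fst v} = {False} \<times> (UNIV :: bool set)"
    by auto
  then show "measure_pmf.prob (role_pmf p) {v. \<not> fst v} = 1 - p"
    using assms by (simp add: role_pmf_def prob_pair_pmf_Times measure_pmf_single)
qed

definition unmatched_before ::
    "(nat \<Rightarrow> 'a set) \<Rightarrow> (nat \<Rightarrow> bool \<times> bool) \<Rightarrow> nat set \<Rightarrow> nat \<Rightarrow> bool" where
  "unmatched_before e x U k \<longleftrightarrow> (\<forall>t\<in>U. t < k \<longrightarrow> \<not> matched_within e x U t)"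

text \<open>The source of independence: matches before \<open>k\<close> are decided by the roles
  before \<open>k\<close>.\<close>

lemma unmatched_before_upd:
  assumes "k \<le> j"
  shows "unmatched_before e (x(j := v)) U k = unmatched_before e x U k"
proof -
  have "matched e (x(j := v)) u s t = matched e x u s t" if "t < k" for u s t
    by (rule matched_cong) (use that assms in auto)
  then show ?thesis
    unfolding unmatched_before_def matched_within_def by blast
qed

lemma unmatched_before_Suc:
  "t \<in> U \<Longrightarrow> unmatched_before e x U (Suc t) \<longleftrightarrow>
     unmatched_before e x U t \<and> \<not> matched_within e x U t"
  by (auto simp: unmatched_before_def less_Suc_eq)

text \<open>
  A sender outside \<open>U\<close> announcing to \<open>t\<close> cannot at the same time divert an earlier pair of \<open>U\<close>; so
  competition at \<open>t\<close> is negatively correlated with the absence of earlier matches.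
\<close>

lemma unmatched_before_release:
  assumes o': "o' \<notin> U" "is_prev e u o' t" "pick (e o') b = u" and "k \<le> t"
    and un: "unmatched_before e (x(o' := (True, b))) U k"
  shows "unmatched_before e x U k"
  unfolding unmatched_before_def
proof (intro ballI impI notI)
  fix t' assume t': "t' \<in> U" "t' < k" "matched_within e x U t'"
  let ?x = "x(o' := (True, b))"
  obtain u' s' where s': "s' \<in> U" and m: "matched e x u' s' t'"
    using t' by (auto simp: matched_within_def)
  have ne: "t' \<noteq> o'" "s' \<noteq> o'"
    using o' t' s' by auto
  \<comment> \<open>Making \<open>o'\<close> a sender creates no new offer at \<open>t'\<close>: its
    announcement reaches \<open>t\<close> only, and \<open>t' < k <= t\<close>.\<close>
  have "offer e x u'' s'' t'" if off: "offer e ?x u'' s'' t'" for u'' s''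
  proof (cases "s'' = o'")
    case True
    with off o'(3) have "is_prev e u o' t'"
      by (auto simp: offer_def)
    with o'(2) have "t' = t"
      by (rule is_prev_unique_right[symmetric])
    with t'(2) \<open>k \<le> t\<close> show ?thesis by simp
  next
    case False
    with off ne show ?thesis
      by (auto simp: offer_def)
  qed
  moreover have "offer e ?x u' s' t'"
    using m ne by (auto simp: matched_def offer_def)
  ultimately have "matched e ?x u' s' t'"
    using m ne unfolding matched_def by auto
  with un t' s' show False
    by (auto simp: unmatched_before_def matched_within_def)
qed

text \<open>The subtracted constant is \<open>p/2 * (1 - p) * (1 - p/4)\<close>. The probability of
  a match at \<open>t\<close> is first compared with that of having no match before
  \<open>r\<close>, rather than before \<open>t\<close>, because the former event is independent of
  the roles of \<open>r\<close> and \<open>t\<close>.\<close>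

lemma prob_unmatched_step:
  fixes e :: "nat \<Rightarrow> 'a set"
  assumes p: "0 \<le> p" "p \<le> 1" and card: "\<And>t. t < n \<Longrightarrow> card (e t) = 2"
    and i: "\<And>t. t \<in> U \<Longrightarrow> i \<in> e t" and t: "t \<in> U" "t < n" and r: "r \<in> U" "is_prev e i r t"
  shows "measure_pmf.prob (Pi_pmf {..<n} d (\<lambda>_. role_pmf p)) {x. unmatched_before e x U (Suc t)} \<le>
         (1 - p * (1 - p) * (4 - p) / 8) *
         measure_pmf.prob (Pi_pmf {..<n} d (\<lambda>_. role_pmf p)) {x. unmatched_before e x U t}"
proof -
  define Pr where "Pr = (\<lambda>Q. measure_pmf.prob (Pi_pmf {..<n} d (\<lambda>_. role_pmf p)) {x. Q x})"
  define N where "N = (\<lambda>k x. unmatched_before e x U k)"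
  define W where "W = (\<lambda>x. matched_within e x U t)"
  have coord: "Pr (\<lambda>x. Q x \<and> R (x j)) = Pr Q * measure_pmf.prob (role_pmf p) {v. R v}"
    if "j < n" "\<And>x v. Q (x(j := v)) = Q x" for Q R j
    unfolding Pr_def by (rule prob_Pi_pmf_coord) (use that in auto)
  have mono: "Pr Q \<le> Pr R" if "\<And>x. Q x \<Longrightarrow> R x" for Q R
    unfolding Pr_def by (rule measure_pmf.finite_measure_mono) (use that in auto)
  have disj: "Pr (\<lambda>x. Q x \<or> R x) = Pr Q + Pr R" if "\<And>x. \<not> (Q x \<and> R x)" for Q R
  proof -
    have "{x. Q x \<or> R x} = {x. Q x} \<union> {x. R x}" by auto
    then show ?thesis
      unfolding Pr_def by (simp, intro measure_pmf.finite_measure_Union) (use that in auto)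
  qed
  have split: "Pr Q = Pr (\<lambda>x. Q x \<and> R x) + Pr (\<lambda>x. Q x \<and> \<not> R x)" for Q R
  proof -
    have "Q = (\<lambda>x. (Q x \<and> R x) \<or> (Q x \<and> \<not> R x))" by auto
    then have "Pr Q = Pr (\<lambda>x. (Q x \<and> R x) \<or> (Q x \<and> \<not> R x))" by simp
    also have "\<dots> = Pr (\<lambda>x. Q x \<and> R x) + Pr (\<lambda>x. Q x \<and> \<not> R x)"
      by (rule disj) auto
    finally show ?thesis .
  qed
  have rt: "r < t" "r < n" "i \<in> e r" "i \<in> e t" and between: "\<And>s. r < s \<Longrightarrow> s < t \<Longrightarrow> i \<notin> e s"
    using r t by (auto simp: is_prev_def)
  obtain bi where bi: "pick (e r) bi = i"
    using pick_surj[OF card[OF rt(2)] rt(3)] by blast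
  obtain ti where ti: "pick (e t) ti = i"
    using pick_surj[OF card[OF t(2)] rt(4)] by blast
  \<comment> \<open>No pair of \<open>U\<close> lies strictly between \<open>r\<close> and
    \<open>t\<close>, and a sender \<open>r\<close> is not matched as a receiver.\<close>
  have Nt: "N t x" if "N r x" "x r = (True, bi)" for x
    unfolding N_def unmatched_before_def
  proof (intro ballI impI)
    fix t' assume t': "t' \<in> U" "t' < t"
    then have "t' < r \<or> t' = r"
      using between i by (metis linorder_neqE_nat)
    then show "\<not> matched_within e x U t'"
      using that t' by (auto simp: N_def unmatched_before_def matched_within_def matched_def offer_def)
  qed
  have indep: "N r (x(j := v)) = N r x" if "r \<le> j" for x j v
    unfolding N_def using that by (rule unmatched_before_upd)
  have offer_i: "offer e x i r t" if "x r = (True, bi)" "\<not> fst (x t)" for x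
    using that r bi by (simp add: offer_def)
  have label: "u' = pick (e t) b" if "u' \<in> e t" "u' \<noteq> i" "pick (e t) b \<noteq> i" for u' b
    using that card[OF t(2)] rt(4) pick_in[OF card[OF t(2)], of b] by (auto simp: card_2_iff)

  text \<open>\<open>o'\<close> below is the only possible competitor of \<open>r\<close> at \<open>t\<close>.\<close>
  have main: "p * (1 - p) * (4 - p) / 8 * Pr (N r) \<le> Pr (\<lambda>x. N t x \<and> W x)"
  proof (cases "\<exists>u o'. is_prev e u o' t \<and> o' \<notin> U")
    \<comment> \<open>Every competing offer now comes from inside \<open>U\<close>, so
      \<open>t\<close> is matched within \<open>U\<close> whichever offer wins, and the factor
      \<open>1 - p/4\<close> is not lost.\<close>
    case False
    have "p * (1 - p) * (4 - p) / 8 * Pr (N r) \<le> Pr (N r) * (p / 2) * (1 - p)"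
    proof -
      have "0 \<le> p * p * (1 - p) * Pr (N r)"
        using p by (simp add: Pr_def)
      then show ?thesis by (simp add: field_simps)
    qed
    also have "\<dots> = Pr (\<lambda>x. (N r x \<and> x r = (True, bi)) \<and> \<not> fst (x t))"
      using rt t indep p by (subst coord, simp, simp, subst coord) (auto simp: prob_role)
    also have "\<dots> \<le> Pr (\<lambda>x. N t x \<and> W x)"
    proof (rule mono)
      fix x assume x: "(N r x \<and> x r = (True, bi)) \<and> \<not> fst (x t)"
      then have off: "offer e x i r t" by (simp add: offer_i)
      have "W x"
      proof (cases "matched e x i r t")
        case True
        then show ?thesis using r by (auto simp: W_def matched_within_def)
      next
        assume "\<not> matched e x i r t"
        with off obtain u' s' where o: "pick (e t) (snd (x t)) \<noteq> i" "u' \<noteq> i" "offer e x u' s' t"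
          by (auto simp: matched_def)
        then have "is_prev e u' s' t" "u' \<in> e t"
          by (auto simp: offer_def is_prev_def)
        then have "s' \<in> U" "matched e x u' s' t"
          using False o label by (auto simp: matched_def)
        then show ?thesis
          by (auto simp: W_def matched_within_def)
      qed
      with x Nt show "N t x \<and> W x" by blast
    qed
    finally show ?thesis .
  next
    case True
    then obtain u o' where o': "is_prev e u o' t" "o' \<notin> U" by blast
    then have o'n: "o' < n" "u \<in> e o'" "u \<in> e t" "o' \<noteq> r" "o' \<noteq> t"
      using t r by (auto simp: is_prev_def)
    have "u \<noteq> i"
      using o' r is_prev_unique_left by metis
    obtain bo where bo: "pick (e o') bo = u"
      using pick_surj[OF card[OF o'n(1)] o'n(2)] by blast
    define Q where "Q = (\<lambda>x. N r x \<and> x o' \<noteq> (True, bo))"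
    \<comment> \<open>Given \<open>N r\<close>, the competing announcement has probability at most
      its unconditional \<open>p / 2\<close>, since forcing it destroys no match within
      \<open>U\<close> before \<open>r\<close>.\<close>
    have "Pr (\<lambda>x. N r x \<and> x o' = (True, bo)) \<le> Pr (N r) * pmf (role_pmf p) (True, bo)"
      unfolding Pr_def N_def
      by (rule prob_Pi_pmf_value_le)
        (use o'n(1) unmatched_before_release[OF o'(2,1) bo] rt in auto)
    also have "pmf (role_pmf p) (True, bo) = p / 2"
      using prob_role(1)[OF p, of bo] by (simp add: measure_pmf_single)
    finally have Q: "Pr Q \<ge> Pr (N r) * (1 - p / 2)"
      using split[of "N r" "\<lambda>x. x o' = (True, bo)"] by (simp add: Q_def algebra_simps)
    \<comment> \<open>Two disjoint ways to match \<open>t\<close> with \<open>r\<close>: the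
      tie-breaking bit of \<open>t\<close> favours \<open>i\<close>, or it does not but the
      competitor does not announce along \<open>u\<close>. Their factors \<open>1\<close> and
      \<open>1 - p / 2\<close> add up to \<open>2 * (1 - p / 4)\<close>.\<close>
    let ?E1 = "\<lambda>x. (N r x \<and> x r = (True, bi)) \<and> x t = (False, ti)"
    let ?E2 = "\<lambda>x. (Q x \<and> x r = (True, bi)) \<and> x t = (False, \<not> ti)"
    have E1: "Pr ?E1 = Pr (N r) * (p / 2) * ((1 - p) / 2)"
      using rt t indep p by (subst coord, simp, simp, subst coord) (auto simp: prob_role)
    have Q_indep: "Q (x(j := v)) = Q x" if "j = r \<or> j = t" for j x v
    proof -
      have "N r (x(j := v)) = N r x"
        using that rt by (intro indep) auto
      then show ?thesis
        using that o'n by (auto simp: Q_def)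
    qed
    have E2: "Pr ?E2 = Pr Q * (p / 2) * ((1 - p) / 2)"
      using rt t Q_indep p by (subst coord, simp, simp, subst coord) (auto simp: prob_role)
    have "p * (1 - p) * (4 - p) / 8 * Pr (N r) =
          Pr (N r) * (p / 2) * ((1 - p) / 2) + Pr (N r) * (1 - p / 2) * ((p / 2) * ((1 - p) / 2))"
      by (simp add: field_simps)
    also have "\<dots> \<le> Pr ?E1 + Pr ?E2"
    proof -
      have "Pr (N r) * (1 - p / 2) * ((p / 2) * ((1 - p) / 2)) \<le> Pr Q * ((p / 2) * ((1 - p) / 2))"
        using Q p by (intro mult_right_mono) auto
      then show ?thesis unfolding E1 E2 by (simp add: mult.assoc)
    qed
    also have "\<dots> = Pr (\<lambda>x. ?E1 x \<or> ?E2 x)"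
      by (rule disj[symmetric]) auto
    also have "\<dots> \<le> Pr (\<lambda>x. N t x \<and> W x)"
    proof (rule mono)
      fix x assume x: "?E1 x \<or> ?E2 x"
      then have x': "N r x" "x r = (True, bi)" "\<not> fst (x t)"
        by (auto simp: Q_def)
      have off: "offer e x i r t"
        using x'(2,3) by (rule offer_i)
      have "matched e x i r t"
      proof (cases "?E1 x")
        case True
        then show ?thesis using off ti by (simp add: matched_def)
      next
        case False
        with x have nb: "x o' \<noteq> (True, bo)"
          by (auto simp: Q_def)
        have "\<not> offer e x u' s' t" if "u' \<noteq> i" for u' s'
        proof
          assume o: "offer e x u' s' t"
          then have u': "is_prev e u' s' t" "u' \<in> e t"
            by (auto simp: offer_def is_prev_def)
          have "u' = u"
            using card[OF t(2)] rt(4) o'n(3) u'(2) \<open>u \<noteq> i\<close> that by (auto simp: card_2_iff)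
          with u' o' have "s' = o'"
            using is_prev_unique_left by metis
          with o \<open>u' = u\<close> have "fst (x o')" "pick (e o') (snd (x o')) = u"
            by (auto simp: offer_def)
          with bo have "x o' = (True, bo)"
            using pick_inj[OF card[OF o'n(1)]] by (metis prod.collapse)
          with nb show False by simp
        qed
        with off show ?thesis
          by (auto simp: matched_def)
      qed
      then have "W x"
        using r by (auto simp: W_def matched_within_def)
      with x' Nt show "N t x \<and> W x" by blast
    qed
    finally show ?thesis .
  qed
  \<comment> \<open>Having no match before \<open>t\<close> is the stronger condition, so the lower
    bound in terms of \<open>N r\<close> carries over to \<open>N t\<close>.\<close>
  have "Pr (N t) \<le> Pr (N r)"
    by (rule mono) (use rt in \<open>auto simp: N_def unmatched_before_def\<close>)
  then have "p * (1 - p) * (4 - p) / 8 * Pr (N t) \<le> p * (1 - p) * (4 - p) / 8 * Pr (N r)"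
    using p by (intro mult_left_mono) auto
  also note main
  finally have "Pr (\<lambda>x. N t x \<and> \<not> W x) \<le> (1 - p * (1 - p) * (4 - p) / 8) * Pr (N t)"
    using split[of "N t" W] by (simp add: algebra_simps)
  then show ?thesis
    by (simp add: Pr_def N_def W_def unmatched_before_Suc[OF t(1)])
qed

text \<open>The step bound is multiplied over the positions of \<open>U\<close> whose predecessor
  lies in \<open>U\<close>; any other position can only shrink the event.\<close>

lemma prob_unmatched_le:
  assumes p: "0 \<le> p" "p \<le> 1" and card: "\<And>t. t < n \<Longrightarrow> card (e t) = 2"
    and i: "\<And>t. t \<in> U \<Longrightarrow> i \<in> e t" and g: "g = p * (1 - p) * (4 - p) / 8" "g \<le> 1"
    and "k \<le> n"
  shows "measure_pmf.prob (Pi_pmf {..<n} d (\<lambda>_. role_pmf p)) {x. unmatched_before e x U k} \<le>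
         (1 - g) ^ card {t \<in> U. t < k \<and> (\<exists>r\<in>U. is_prev e i r t)}"
  using \<open>k \<le> n\<close>
proof (induction k)
  case 0
  then show ?case by simp
next
  case (Suc k)
  let ?P = "\<lambda>k. measure_pmf.prob (Pi_pmf {..<n} d (\<lambda>_. role_pmf p)) {x. unmatched_before e x U k}"
  let ?C = "\<lambda>k. {t \<in> U. t < k \<and> (\<exists>r\<in>U. is_prev e i r t)}"
  have IH: "?P k \<le> (1 - g) ^ card (?C k)"
    using Suc by simp
  have fin: "finite (?C k)"
    by (rule finite_subset[of _ "{..<k}"]) auto
  show ?case
  proof (cases "k \<in> U \<and> (\<exists>r\<in>U. is_prev e i r k)")
    case True
    then obtain r where r: "k \<in> U" "r \<in> U" "is_prev e i r k" by blast
    have "?C (Suc k) = insert k (?C k)"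
      using True by (auto simp: less_Suc_eq)
    then have card_Suc: "card (?C (Suc k)) = Suc (card (?C k))"
      using fin by simp
    have "?P (Suc k) \<le> (1 - g) * ?P k"
      unfolding g(1) using p card i r(1) _ r(2,3)
      by (rule prob_unmatched_step) (use Suc in auto)
    also have "\<dots> \<le> (1 - g) * (1 - g) ^ card (?C k)"
      using IH g(2) by (intro mult_left_mono) auto
    finally show ?thesis
      unfolding card_Suc by simp
  next
    case False
    then have "?C (Suc k) = ?C k"
      by (auto simp: less_Suc_eq)
    moreover have "?P (Suc k) \<le> ?P k"
      by (intro measure_pmf.finite_measure_mono) (auto simp: unmatched_before_def)
    ultimately show ?thesis
      using IH by simp
  qed
qed

section \<open>Averaging over roles and coins\<close>

lemma prob_pair_pmf_le:
  assumes "\<And>x. measure_pmf.prob q {c. R x c} \<le> (if G x then k else 0)" and "0 \<le> k"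
  shows "measure_pmf.prob (pair_pmf p q) {(x, c). R x c} \<le> k * measure_pmf.prob p {x. G x}"
proof -
  have "emeasure (pair_pmf p q) {(x, c). R x c} =
        (\<integral>\<^sup>+x. \<integral>\<^sup>+c. indicator {(x, c). R x c} (x, c) \<partial>q \<partial>p)"
    by (simp flip: nn_integral_pair_pmf')
  also have "\<dots> = (\<integral>\<^sup>+x. emeasure q {c. R x c} \<partial>p)"
  proof (rule nn_integral_cong)
    fix x
    have "(\<lambda>c. indicator {(x, c). R x c} (x, c)) = (indicator {c. R x c} :: _ \<Rightarrow> ennreal)"
      by (auto simp: indicator_def)
    then show "(\<integral>\<^sup>+c. indicator {(x, c). R x c} (x, c) \<partial>q) = emeasure q {c. R x c}"
      by simp
  qed
  also have "\<dots> \<le> (\<integral>\<^sup>+x. ennreal k * indicator {x. G x} x \<partial>p)"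
  proof (rule nn_integral_mono)
    fix x
    show "emeasure q {c. R x c} \<le> ennreal k * indicator {x. G x} x"
      using assms(1)[of x]
      by (cases "G x") (simp_all add: measure_pmf.emeasure_eq_measure ennreal_leI measure_le_0_iff)
  qed
  also have "\<dots> = ennreal k * emeasure p {x. G x}"
    by (subst nn_integral_cmult_indicator) auto
  finally show ?thesis
    using \<open>0 \<le> k\<close> by (simp add: measure_pmf.emeasure_eq_measure flip: ennreal_mult)
qed

definition seed_pmf :: "real \<Rightarrow> ((bool \<times> bool) \<times> bool) pmf" where
  "seed_pmf p = pair_pmf (role_pmf p) (bernoulli_pmf (1/2))"

text \<open>The roles are drawn first. If they yield a match within \<open>U\<close>, then
  \<open>i\<close> is certainly selected; otherwise the coins miss it with probability at most
  \<open>(1/2) ^ card U\<close>.\<close>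

lemma prob_unselected_le:
  assumes p: "0 \<le> p" "p \<le> 1" and card: "\<And>t. t < n \<Longrightarrow> card (e t) = 2"
    and U: "U \<subseteq> {..<n}" and i: "\<And>t. t \<in> U \<Longrightarrow> i \<in> e t"
    and g: "g = p * (1 - p) * (4 - p) / 8" "g \<le> 1"
  shows "measure_pmf.prob (Pi_pmf {..<n} (d, d') (\<lambda>_. seed_pmf p))
           {w. \<forall>t\<in>U. selection e (fst \<circ> w) (snd \<circ> w) t \<noteq> i} \<le>
         (1/2) ^ card U * (1 - g) ^ card {t \<in> U. \<exists>r\<in>U. is_prev e i r t}"
proof -
  let ?P = "Pi_pmf {..<n} d (\<lambda>_. role_pmf p)"
  let ?Q = "Pi_pmf {..<n} d' (\<lambda>_. bernoulli_pmf (1/2))"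
  have cardU: "card (e t) = 2" if "t \<in> U" for t
    using that U card by auto
  have "measure_pmf.prob (Pi_pmf {..<n} (d, d') (\<lambda>_. seed_pmf p))
           {w. \<forall>t\<in>U. selection e (fst \<circ> w) (snd \<circ> w) t \<noteq> i} =
        measure_pmf.prob (pair_pmf ?P ?Q) {(x, c). \<forall>t\<in>U. selection e x c t \<noteq> i}"
  proof -
    have "(\<lambda>(x, c) t. (x t, c t)) -` {w. \<forall>t\<in>U. selection e (fst \<circ> w) (snd \<circ> w) t \<noteq> i} =
          {(x, c). \<forall>t\<in>U. selection e x c t \<noteq> i}"
      by (auto simp: comp_def)
    then show ?thesis
      by (simp add: seed_pmf_def Pi_pmf_pair)
  qed
  also have "\<dots> \<le> (1/2) ^ card U * measure_pmf.prob ?P {x. unmatched_before e x U n}"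
  proof (rule prob_pair_pmf_le)
    fix x
    show "measure_pmf.prob ?Q {c. \<forall>t\<in>U. selection e x c t \<noteq> i} \<le>
          (if unmatched_before e x U n then (1/2) ^ card U else 0)"
    proof (cases "unmatched_before e x U n")
      case True
      then have "measure_pmf.prob ?Q {c. \<forall>t\<in>U. selection e x c t \<noteq> i} \<le> (1/2) ^ card U"
        using U by (intro prob_coins_unselected_le[OF U card i]) (auto simp: unmatched_before_def)
      with True show ?thesis by simp
    next
      case False
      then have "\<exists>t\<in>U. selection e x c t = i" for c
        using selected_if_matched_within[OF cardU i] by (auto simp: unmatched_before_def)
      then have "{c. \<forall>t\<in>U. selection e x c t \<noteq> i} = {}"
        by auto
      with False show ?thesis by (simp only: measure_empty if_False order_refl)
    qed
  qed simp
  also have "\<dots> \<le> (1/2) ^ card U * (1 - g) ^ card {t \<in> U. t < n \<and> (\<exists>r\<in>U. is_prev e i r t)}"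
    by (intro mult_left_mono prob_unmatched_le[OF p card i g]) auto
  also have "{t \<in> U. t < n \<and> (\<exists>r\<in>U. is_prev e i r t)} = {t \<in> U. \<exists>r\<in>U. is_prev e i r t}"
    using U by auto
  finally show ?thesis .
qed

subsection \<open>The online algorithm\<close>

text \<open>The predecessor is the largest earlier position containing \<open>i\<close>. It is at
  least \<open>Min S\<close>, so consecutiveness puts it into \<open>S\<close>. This yields the
  exponents \<open>card (S l) - 1\<close>.\<close>

lemma consecutive_wrt_prev:
  assumes S: "consecutive_wrt es i S" and t: "t \<in> S" "t \<noteq> Min S"
  shows "\<exists>r\<in>S. is_prev ((!) es) i r t"
proof -
  have sub: "S \<subseteq> positions_containing es i"
    using S by (simp add: consecutive_wrt_def)
  then have fin: "finite S"
    by (rule finite_subset) (simp add: positions_containing_def)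
  have less: "Min S < t" "t \<le> Max S"
    using fin t(1) Min_le[OF fin t(1)] t(2) by (linarith, simp)
  have MinS: "Min S \<in> S"
    using fin t by (intro Min_in) auto
  define T where "T = {r. r < t \<and> r \<in> positions_containing es i}"
  have finT: "finite T"
    unfolding T_def by simp
  have MinT: "Min S \<in> T"
    using MinS less sub by (auto simp: T_def)
  then have MaxT: "Max T \<in> T" "Min S \<le> Max T"
    using Max_in[OF finT] Max_ge[OF finT] by blast+
  then have "Max T < t" "Max T \<in> positions_containing es i"
    by (simp_all only: T_def mem_Collect_eq)
  then have "Max T \<in> S"
    using S less MaxT(2) unfolding consecutive_wrt_def by (metis le_trans less_imp_le)
  moreover have "i \<notin> es ! r" if "Max T < r" "r < t" for r
  proof
    assume "i \<in> es ! r"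
    with that t sub have "r \<in> T"
      by (auto simp: T_def positions_containing_def)
    then have "r \<le> Max T"
      using finT by simp
    with that show False by simp
  qed
  ultimately show ?thesis
    using \<open>Max T < t\<close> \<open>Max T \<in> positions_containing es i\<close> t sub
    by (intro bexI[of _ "Max T"]) (auto simp: is_prev_def positions_containing_def)
qed

definition algorithm :: "(nat \<Rightarrow> (bool \<times> bool) \<times> bool) \<Rightarrow> 'a selector" where
  "algorithm w es = selection ((!) es) (fst \<circ> w) (snd \<circ> w) (length es - 1)"

lemma algorithm_take:
  assumes "t < length es"
  shows "algorithm w (take (Suc t) es) = selection ((!) es) (fst \<circ> w) (snd \<circ> w) t"
proof -
  have "length (take (Suc t) es) - 1 = t"
    using assms by simp
  then show ?thesis
    unfolding algorithm_def by (simp, intro selection_cong) auto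
qed

lemma algorithm_truncate:
  assumes "length es - 1 < n"
  shows "algorithm (\<lambda>t. if t < n then w t else d) es = algorithm w es"
  unfolding algorithm_def by (rule selection_cong) (use assms in auto)

lemma online_selector_algorithm: "online_selector (algorithm w)"
  unfolding online_selector_def
proof (intro allI impI)
  fix es :: "'a set list" assume es: "es \<noteq> []" "pair_sequence es"
  then have "card (es ! (length es - 1)) = 2"
    by (simp add: pair_sequence_def)
  from selection_in[of "(!) es", OF this] es show "algorithm w es \<in> last es"
    by (simp add: algorithm_def last_conv_nth)
qed

section \<open>The seed space and the induced measure on selectors\<close>

definition seeds :: "real \<Rightarrow> (nat \<Rightarrow> (bool \<times> bool) \<times> bool) measure" where
  "seeds p = PiM UNIV (\<lambda>_. measure_pmf (seed_pmf p))"

text \<open>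
  The restriction is needed because \<open>randomized_online_selector\<close> asks every point of the space, not
  just almost every point, to be an online selector.
\<close>

definition selectors :: "'a selector measure" where
  "selectors = restrict_space (PiM UNIV (\<lambda>_. count_space UNIV)) {A. online_selector A}"

lemma space_selectors: "space selectors = {A. online_selector A}"
  by (simp add: selectors_def space_restrict_space space_PiM)

lemma measurable_selectors_component:
  "(\<lambda>A. A es) \<in> measurable selectors (count_space UNIV)"
  unfolding selectors_def by (intro measurable_restrict_space1 measurable_component_singleton) simp

lemma measurable_algorithm: "(algorithm :: _ \<Rightarrow> 'a selector) \<in> measurable (seeds p) selectors"
proof -
  have "(\<lambda>w. algorithm w es) \<in> measurable (seeds p) (count_space UNIV)" for es :: "'a set list"
  proof (rule measurableI)
    fix X :: "'a set"
    \<comment> \<open>The bound \<open>Suc (length es)\<close> also covers the empty list, on which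
      \<open>algorithm\<close> reads the seed at position 0.\<close>
    have "{w \<in> space (seeds p). algorithm (\<lambda>t. if t < Suc (length es) then w t else undefined) es \<in> X}
          \<in> sets (seeds p)"
      unfolding seeds_def
      by (rule measure_PiM_finite_prefix(1)[where Q = "\<lambda>w. algorithm w es \<in> X"])
    then show "(\<lambda>w. algorithm w es) -` X \<inter> space (seeds p) \<in> sets (seeds p)"
      by (simp add: algorithm_truncate vimage_def Int_def conj_commute)
  qed simp
  then have "(\<lambda>w (es :: 'a set list). algorithm w es) \<in> measurable (seeds p) (PiM UNIV (\<lambda>_. count_space UNIV))"
    by (intro measurable_PiM_single') auto
  then show ?thesis
    unfolding selectors_def
    by (intro measurable_restrict_space2) (auto simp: online_selector_algorithm)
qed

lemma OCS_algorithm: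
  assumes p: "0 \<le> p" "p \<le> 1" and g: "g = p * (1 - p) * (4 - p) / 8" "0 \<le> g" "g \<le> 1"
  shows "OCS g (distr (seeds p) selectors algorithm :: 'a selector measure)"
proof -
  let ?M = "distr (seeds p) selectors algorithm :: 'a selector measure"
  interpret seeds: prob_space "seeds p"
    unfolding seeds_def by (intro prob_space_PiM) (rule prob_space_measure_pmf)
  interpret M: prob_space ?M
    by (rule seeds.prob_space_distr) (rule measurable_algorithm)
  have rand: "randomized_online_selector ?M"
    unfolding randomized_online_selector_def
    using M.prob_space_axioms measurable_selectors_component by (auto simp: space_selectors)
  have bound: "1 - (\<Prod>l<m. (1 / 2) ^ card (S l) * (1 - g) ^ (card (S l) - 1)) \<le>
      measure ?M {A \<in> space ?M. \<exists>l<m. \<exists>t\<in>S l. A (take (Suc t) es) = i}"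
    if es: "pair_sequence es" and S: "\<And>l :: nat. l < m \<Longrightarrow> consecutive_wrt es i (S l)"
      and disj: "disjoint_family_on S {..<m}" for es :: "'a set list" and i m S
  proof -
    define n where "n = length es"
    define U where "U = (\<Union>l<m. S l)"
    have pos: "S l \<subseteq> positions_containing es i" "S l \<noteq> {}" if "l < m" for l
      using S[OF that] by (auto simp: consecutive_wrt_def)
    have finS: "finite (S l)" if "l < m" for l
      using pos(1)[OF that] by (rule finite_subset) (simp add: positions_containing_def)
    have U: "U \<subseteq> {..<n}"
      using pos by (auto simp: U_def n_def positions_containing_def)
    have iU: "i \<in> es ! t" if "t \<in> U" for t
      using pos that by (auto simp: U_def positions_containing_def)
    have finU: "finite U"
      using U by (rule finite_subset) simp
    have card: "card (es ! t) = 2" if "t < n" for t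
      using es that by (simp add: pair_sequence_def n_def)
    have cardU: "card U = (\<Sum>l<m. card (S l))"
      unfolding U_def using finS disj by (intro card_UN_disjoint) (auto simp: disjoint_family_on_def)
    let ?R = "{t \<in> U. \<exists>r\<in>U. is_prev ((!) es) i r t}"
    have "(\<Sum>l<m. card (S l) - 1) = (\<Sum>l<m. card (S l - {Min (S l)}))"
      using finS pos by (intro sum.cong refl) (simp add: card_Diff_singleton)
    also have "\<dots> = card (\<Union>l<m. S l - {Min (S l)})"
      using finS disj by (intro card_UN_disjoint[symmetric]) (auto simp: disjoint_family_on_def)
    \<comment> \<open>The inequality can be strict: the minimum of one subsequence may directly
      follow the last position of another.\<close>
    also have "\<dots> \<le> card ?R"
    proof (rule card_mono)
      show "(\<Union>l<m. S l - {Min (S l)}) \<subseteq> ?R"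
      proof
        fix t assume "t \<in> (\<Union>l<m. S l - {Min (S l)})"
        then obtain l where l: "l < m" "t \<in> S l" "t \<noteq> Min (S l)" by auto
        then obtain r where "r \<in> S l" "is_prev ((!) es) i r t"
          using consecutive_wrt_prev[OF S] by blast
        with l show "t \<in> ?R"
          by (auto simp: U_def)
      qed
    qed (use finU in auto)
    finally have cardR: "(\<Sum>l<m. card (S l) - 1) \<le> card ?R" .

    define E where "E = {A \<in> space ?M. \<exists>l<m. \<exists>t\<in>S l. A (take (Suc t) es) = i}"
    have E: "E = (\<Union>t\<in>U. (\<lambda>A. A (take (Suc t) es)) -` {i} \<inter> space selectors)"
      by (auto simp: E_def U_def)
    have setsE: "E \<in> sets ?M"
      unfolding E sets_distr using finU
      by (intro sets.finite_UN measurable_sets[OF measurable_selectors_component]) auto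
    have "1 - measure ?M E = measure ?M (space ?M - E)"
      using M.prob_compl[OF setsE] by simp
    also have "\<dots> = measure (seeds p) (algorithm -` (space ?M - E) \<inter> space (seeds p))"
      using setsE by (intro measure_distr measurable_algorithm) auto
    also have "algorithm -` (space ?M - E) \<inter> space (seeds p) =
        {w \<in> space (seeds p). \<forall>t\<in>U. selection ((!) es) (fst \<circ> w) (snd \<circ> w) t \<noteq> i}"
      using U by (auto simp: E space_selectors online_selector_algorithm algorithm_take n_def subset_iff)
    \<comment> \<open>Only the first \<open>n\<close> seeds matter; the fixed padding brings the
      event into the form of \<open>measure_PiM_finite_prefix\<close>.\<close>
    also have "\<dots> = {w \<in> space (seeds p). \<forall>t\<in>U.
        selection ((!) es) (fst \<circ> (\<lambda>t. if t < n then w t else ((False, False), False)))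
          (snd \<circ> (\<lambda>t. if t < n then w t else ((False, False), False))) t \<noteq> i}"
    proof (intro Collect_cong conj_cong ball_cong refl arg_cong[where f = Not] arg_cong2[where f = "(=)"])
      fix w t assume "t \<in> U"
      with U have "t < n" by auto
      then show "selection ((!) es) (fst \<circ> w) (snd \<circ> w) t =
        selection ((!) es) (fst \<circ> (\<lambda>t. if t < n then w t else ((False, False), False)))
          (snd \<circ> (\<lambda>t. if t < n then w t else ((False, False), False))) t"
        by (intro selection_cong) auto
    qed
    also have "measure (seeds p) \<dots> =
        measure_pmf.prob (Pi_pmf {..<n} ((False, False), False) (\<lambda>_. seed_pmf p))
          {w. \<forall>t\<in>U. selection ((!) es) (fst \<circ> w) (snd \<circ> w) t \<noteq> i}"
      unfolding seeds_def
      by (rule measure_PiM_finite_prefix(2)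
          [where Q = "\<lambda>w. \<forall>t\<in>U. selection ((!) es) (fst \<circ> w) (snd \<circ> w) t \<noteq> i"])
    also have "\<dots> \<le> (1/2) ^ card U * (1 - g) ^ card ?R"
      using U by (intro prob_unselected_le[OF p card _ iU g(1,3)]) auto
    also have "\<dots> \<le> (1/2) ^ card U * (1 - g) ^ (\<Sum>l<m. card (S l) - 1)"
      using g cardR by (intro mult_left_mono power_decreasing) auto
    also have "\<dots> = (\<Prod>l<m. (1 / 2) ^ card (S l) * (1 - g) ^ (card (S l) - 1))"
      by (simp add: cardU power_sum prod.distrib)
    finally show ?thesis
      unfolding E_def by simp
  qed
  show ?thesis
    unfolding OCS_def using g(2,3) rand bound by (intro conjI allI impI) simp_all
qed

theorem theorem3:
  fixes \<gamma> :: real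
  assumes "\<gamma> = (13 * sqrt 13 - 35) / 108"
  shows "(\<exists>M :: 'a selector measure. OCS \<gamma> M) \<and> \<gamma> > 0.1099"
proof -
  \<comment> \<open>The smaller root of \<open>3 * p^2 - 10 * p + 4\<close>, the derivative of
    \<open>p * (1 - p) * (4 - p)\<close>.\<close>
  define p where "p = (5 - sqrt 13) / 3"
  \<comment> \<open>The lower bound yields \<open>p <= 1\<close> and
    \<open>\<gamma> > 0.1099\<close>, the upper bound below yields \<open>0 <= p\<close> and
    \<open>\<gamma> <= 1\<close>.\<close>
  have "3.6055 < sqrt (13 :: real)"
    by (rule real_less_rsqrt) (simp add: power2_eq_square)
  moreover have "sqrt (13 :: real) < 3.61"
    by (rule real_less_lsqrt) (simp_all add: power2_eq_square)
  moreover have "p * (1 - p) * (4 - p) / 8 = \<gamma>"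
    unfolding assms p_def by (simp add: field_simps power2_eq_square)
  ultimately show ?thesis
    using OCS_algorithm[of p \<gamma>] by (intro conjI exI[of _ "distr (seeds p) selectors algorithm"])
      (simp_all add: assms p_def)
qed

end
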